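(* Let $\mu$ be a probability measure on $\mathbb{R}^n$ whose support is not included in a hyperplane. Let $V\subset\mathbb{R}^n$ be a measurable subset and let $\lambda\in\mathrm{int}(\mathcal{D}_{\Lambda_\mu})$. Then $$\mu(V)\ge e^{-\Lambda^*_\mu(y)}\,\mu_y(V)\,\exp\Big(-\frac{1}{\mu_y(V)^{1/2}}\,\langle\lambda,\nabla^2\Lambda_\mu(\lambda)\lambda\rangle^{1/2}\Big),$$ where $y=\nabla\Lambda_\mu(\lambda)$ and $\mu_y$ is the probability measure $d\mu_y(x)=e^{\langle\lambda,x\rangle-\Lambda_\mu(\lambda)}d\mu(x)$.
   Context: The logarithmic Laplace transform of $\mu$ is $\Lambda_\mu(\lambda)=\log\int e^{\langle\lambda,x\rangle}d\mu(x)$, $\lambda\in\mathbb{R}^n$, with domain $\mathcal{D}_{\Lambda_\mu}=\{\lambda:\Lambda_\mu(\lambda)<+\infty\}$; it is $C^\infty$ on the interior of its domain. Its Legendre transform is $\Lambda^*_\mu(x)=\sup_{\lambda\in\mathbb{R}^n}\{\langle\lambda,x\rangle-\Lambda_\mu(\lambda)\}$. The right-hand side of the inequality is read as $0$ when $\mu_y(V)=0$. *)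

theory Defs
  imports "HOL-Probability.Probability"
begin

definition measure_support :: "'a::topological_space measure \<Rightarrow> 'a set" where
  "measure_support M = {x. \<forall>U. open U \<and> x \<in> U \<longrightarrow> emeasure M U > 0}"

(* Hyperplanes are affine: the offset b is arbitrary. *)
definition hyperplane :: "'a::real_inner set \<Rightarrow> bool" where
  "hyperplane H \<longleftrightarrow> (\<exists>a b. a \<noteq> 0 \<and> H = {x. a \<bullet> x = b})"

definition log_ennreal :: "ennreal \<Rightarrow> ereal" where
  "log_ennreal t = (if t = 0 then -\<infinity> else if t = \<infinity> then \<infinity> else ereal (ln (enn2real t)))"

definition exp_ereal :: "ereal \<Rightarrow> ennreal" where
  "exp_ereal t = (if t = -\<infinity> then 0 else if t = \<infinity> then \<infinity> else ennreal (exp (real_of_ereal t)))"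

definition log_laplace :: "'a::real_inner measure \<Rightarrow> 'a \<Rightarrow> ereal" where
  "log_laplace M l = log_ennreal (\<integral>\<^sup>+ x. ennreal (exp (l \<bullet> x)) \<partial>M)"

definition effective_domain :: "('a \<Rightarrow> ereal) \<Rightarrow> 'a set" where
  "effective_domain f = {x. f x < \<infinity>}"

definition legendre :: "('a::real_inner \<Rightarrow> ereal) \<Rightarrow> 'a \<Rightarrow> ereal" where
  "legendre f x = (SUP l. ereal (l \<bullet> x) - f l)"

definition tilted_measure :: "'a::real_inner measure \<Rightarrow> 'a \<Rightarrow> 'a measure" where
  "tilted_measure M l = density M (\<lambda>x. exp_ereal (ereal (l \<bullet> x) - log_laplace M l))"

(* Gradient and Hessian of an extended-real function refer to its real-valued version;
   they are meaningful at interior points of the set where the function is finite. *)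
definition gradient :: "('a::real_inner \<Rightarrow> ereal) \<Rightarrow> 'a \<Rightarrow> 'a" where
  "gradient f x = (THE D. GDERIV (\<lambda>z. real_of_ereal (f z)) x :> D)"

definition hessian :: "(real ^ 'n \<Rightarrow> ereal) \<Rightarrow> real ^ 'n \<Rightarrow> real ^ 'n ^ 'n" where
  "hessian f x = jacobian (gradient f) (at x)"

end

theory Submission
  imports Defs
begin

text \<open>
  Only the trivial bound \<open>\<Lambda>\<^sup>*(y) \<ge> \<langle>\<lambda>, y\<rangle> - \<Lambda>(\<lambda>)\<close> is used, so it suffices to bound
  \<open>\<mu>(V) = exp (\<Lambda>(\<lambda>) - \<langle>\<lambda>, y\<rangle>) \<integral>\<^sub>V exp (- \<langle>\<lambda>, x - y\<rangle>) d\<mu>\<^sub>y\<close> from below. Jensen's inequality for the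
  normalised restriction of \<open>\<mu>\<^sub>y\<close> to \<open>V\<close>, followed by Cauchy-Schwarz, leaves the \<open>\<mu>\<^sub>y\<close>-mean of
  \<open>\<langle>\<lambda>, x - y\<rangle>\<^sup>2\<close>. Differentiating under the integral sign shows that \<open>y\<close> is the mean and
  \<open>\<nabla>\<^sup>2\<Lambda>(\<lambda>)\<close> the covariance of \<open>\<mu>\<^sub>y\<close>, so this second moment is \<open>\<langle>\<lambda>, \<nabla>\<^sup>2\<Lambda>(\<lambda>) \<lambda>\<rangle>\<close>.
\<close>

section \<open>Elementary bounds on the exponential\<close>

text \<open>Lagrange form of the second-order Taylor remainder. The factor
  \<open>exp \<bar>t\<bar>\<close> makes the estimate valid for all \<open>t\<close>, so it can
  later serve pointwise under an integral over an unbounded space.\<close>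

lemma exp_taylor2_bound:
  fixes t :: real
  shows "\<bar>exp t - 1 - t\<bar> \<le> t\<^sup>2 * exp \<bar>t\<bar>"
proof (cases "t = 0")
  case False
  then obtain s where s: "\<bar>s\<bar> < \<bar>t\<bar>"
    and eq: "exp t = (\<Sum>m<2. (t ^ m) / fact m) + (exp s / fact 2) * t ^ 2"
    using Maclaurin_exp_lt[of t 2] by auto
  have "exp t - 1 - t = exp s / 2 * t\<^sup>2"
    using eq by (simp add: numeral_2_eq_2)
  moreover have "exp s / 2 \<le> exp \<bar>t\<bar>"
  proof -
    have "exp s \<le> exp \<bar>t\<bar>" using s by simp
    then show ?thesis using exp_gt_zero[of s] by linarith
  qed
  ultimately have "\<bar>exp t - 1 - t\<bar> = exp s / 2 * t\<^sup>2" "exp s / 2 * t\<^sup>2 \<le> exp \<bar>t\<bar> * t\<^sup>2"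
    by (simp_all only: abs_mult abs_divide abs_power2 abs_exp_cancel abs_numeral mult_right_mono zero_le_power2)
  then show ?thesis by (simp only: mult.commute)
qed simp

text \<open>Some coordinate carries at least the fraction \<open>1 / DIM('a)\<close> of the norm,
  and the exponential of that coordinate with the right sign already dominates; summing over all
  signed basis vectors removes the dependence on \<open>x\<close>. An exponential moment of the norm
  thus reduces to finitely many Laplace integrals.\<close>

lemma exp_norm_le_sum_Basis:
  fixes x :: "'a::euclidean_space"
  assumes "d \<ge> 0"
  shows "exp (d * norm x) \<le>
    (\<Sum>b\<in>Basis. exp ((d * DIM('a)) *\<^sub>R b \<bullet> x) + exp (- ((d * DIM('a)) *\<^sub>R b) \<bullet> x))"
proof -
  \<comment> \<open>Pigeonhole against the l1 norm: if every coordinate were below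
    \<open>norm x / DIM('a)\<close>, their absolute values would sum to less than
    \<open>norm x\<close>.\<close>
  obtain b where b: "b \<in> (Basis :: 'a set)" "norm x \<le> DIM('a) * \<bar>b \<bullet> x\<bar>"
  proof (rule ccontr)
    assume "\<not> thesis"
    then have less: "\<And>b. b \<in> (Basis :: 'a set) \<Longrightarrow> \<bar>x \<bullet> b\<bar> < norm x / DIM('a)"
      using that by (force simp: field_simps inner_commute)
    have "(\<Sum>b\<in>Basis. \<bar>x \<bullet> b\<bar>) < (\<Sum>b\<in>(Basis :: 'a set). norm x / DIM('a))"
      using less by (intro sum_strict_mono) auto
    then show False
      using norm_le_l1[of x] by simp
  qed
  have "d * norm x \<le> d * (DIM('a) * \<bar>b \<bullet> x\<bar>)"
    using b(2) assms by (rule mult_left_mono)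
  then have "exp (d * norm x) \<le> exp \<bar>d * DIM('a) * (b \<bullet> x)\<bar>"
    using assms by (simp add: abs_mult)
  also have "\<dots> \<le> exp ((d * DIM('a)) *\<^sub>R b \<bullet> x) + exp (- ((d * DIM('a)) *\<^sub>R b) \<bullet> x)"
    by (cases "d * DIM('a) * (b \<bullet> x) \<ge> 0") (auto simp: abs_if)
  also have "\<dots> \<le> (\<Sum>b\<in>Basis. exp ((d * DIM('a)) *\<^sub>R b \<bullet> x) + exp (- ((d * DIM('a)) *\<^sub>R b) \<bullet> x))"
    using b(1) by (intro member_le_sum) auto
  finally show ?thesis .
qed

text \<open>The cube of a linear bound with rate \<open>e / 3\<close>. Cubic growth costs only an
  arbitrarily small exponential rate; degree three is what a quadratic Taylor remainder times a
  function of linear growth requires.\<close>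

lemma cubic_le_exp:
  fixes t e :: real
  assumes "t \<ge> 0" "e > 0"
  shows "(1 + t) ^ 3 \<le> (1 + 3 / e) ^ 3 * exp (e * t)"
proof -
  have "1 + e * t / 3 \<le> exp (e * t / 3)" by (rule exp_ge_add_one_self)
  moreover have "1 + t \<le> (1 + 3 / e) * (1 + e * t / 3)"
    using assms by (simp add: field_simps)
  ultimately have "1 + t \<le> (1 + 3 / e) * exp (e * t / 3)"
    using assms by (smt (verit) mult_left_mono divide_pos_pos)
  then have "(1 + t) ^ 3 \<le> ((1 + 3 / e) * exp (e * t / 3)) ^ 3"
    using assms by (intro power_mono) auto
  also have "\<dots> = (1 + 3 / e) ^ 3 * exp (e * t)"
    by (simp add: power_mult_distrib flip: exp_of_nat_mult)
  finally show ?thesis .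
qed

section \<open>Exponential integrability at interior points of the domain\<close>

lemma log_ennreal_eq_top_iff: "log_ennreal t = \<infinity> \<longleftrightarrow> t = \<infinity>"
  by (simp add: log_ennreal_def)

lemma integrable_exp_inner_iff:
  fixes M :: "'a::euclidean_space measure"
  assumes [measurable_cong, simp]: "sets M = sets borel"
  shows "integrable M (\<lambda>x. exp (l \<bullet> x)) \<longleftrightarrow> l \<in> effective_domain (log_laplace M)"
  by (simp add: integrable_iff_bounded effective_domain_def log_laplace_def log_ennreal_eq_top_iff
    flip: less_top)

text \<open>The points \<open>l + r *\<^sub>R b\<close> and \<open>l - r *\<^sub>R b\<close> lie in
  the domain for small \<open>r\<close>, and the sum of their exponentials dominates. The surplus
  rate \<open>e\<close> is the reserve on which all later domination arguments draw.\<close>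

lemma integrable_exp_inner_norm:
  fixes M :: "'a::euclidean_space measure"
  assumes [measurable_cong]: "sets M = sets borel"
    and "l \<in> interior (effective_domain (log_laplace M))"
  shows "\<exists>e>0. integrable M (\<lambda>x. exp (l \<bullet> x + e * norm x))"
proof -
  obtain r where r: "r > 0" "cball l r \<subseteq> effective_domain (log_laplace M)"
    using assms(2) by (auto simp: mem_interior_cball)
  \<comment> \<open>Chosen so that the vectors \<open>(e * DIM('a)) *\<^sub>R b\<close> of
    \<open>exp_norm_le_sum_Basis\<close> have length exactly \<open>r\<close>.\<close>
  define e where "e = r / DIM('a)"
  have e: "e > 0" "e * DIM('a) = r" using r by (auto simp: e_def)
  have I: "integrable M (\<lambda>x. exp (z \<bullet> x))" if "dist l z \<le> r" for z
    using that r assms(1) by (subst integrable_exp_inner_iff) auto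
  have "integrable M (\<lambda>x. \<Sum>b\<in>Basis. exp ((l + r *\<^sub>R b) \<bullet> x) + exp ((l - r *\<^sub>R b) \<bullet> x))"
    using r by (intro Bochner_Integration.integrable_sum Bochner_Integration.integrable_add I)
      (auto simp: dist_norm)
  then have "integrable M (\<lambda>x. exp (l \<bullet> x + e * norm x))"
  proof (rule Bochner_Integration.integrable_bound)
    show "AE x in M. norm (exp (l \<bullet> x + e * norm x)) \<le>
        norm (\<Sum>b\<in>Basis. exp ((l + r *\<^sub>R b) \<bullet> x) + exp ((l - r *\<^sub>R b) \<bullet> x))"
    proof (rule AE_I2)
      fix x
      have "exp (l \<bullet> x + e * norm x) \<le>
          exp (l \<bullet> x) * (\<Sum>b\<in>Basis. exp (r *\<^sub>R b \<bullet> x) + exp (- (r *\<^sub>R b) \<bullet> x))"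
        using exp_norm_le_sum_Basis[of e x] e by (simp add: exp_add)
      also have "\<dots> = (\<Sum>b\<in>Basis. exp ((l + r *\<^sub>R b) \<bullet> x) + exp ((l - r *\<^sub>R b) \<bullet> x))"
        by (simp add: sum_distrib_left inner_add_left inner_diff_left exp_add exp_diff exp_minus
            field_simps)
      finally show "norm (exp (l \<bullet> x + e * norm x)) \<le>
        norm (\<Sum>b\<in>Basis. exp ((l + r *\<^sub>R b) \<bullet> x) + exp ((l - r *\<^sub>R b) \<bullet> x))"
        by simp
    qed
  qed measurable
  then show ?thesis using e by blast
qed

text \<open>By Cauchy-Schwarz, moving the exponent from \<open>l\<close> to \<open>z\<close> uses up
  \<open>dist l z\<close> of the reserve \<open>e\<close>; whatever is left may be kept as
  \<open>d\<close>.\<close>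

lemma integrable_exp_inner_norm_nearby:
  fixes M :: "'a::euclidean_space measure"
  assumes [measurable_cong]: "sets M = sets borel"
    and "integrable M (\<lambda>x. exp (l \<bullet> x + e * norm x))" and "dist l z + d \<le> e"
  shows "integrable M (\<lambda>x. exp (z \<bullet> x + d * norm x))"
  using assms(2)
proof (rule Bochner_Integration.integrable_bound)
  show "AE x in M. norm (exp (z \<bullet> x + d * norm x)) \<le> norm (exp (l \<bullet> x + e * norm x))"
  proof (rule AE_I2)
    fix x
    have "(z - l) \<bullet> x \<le> dist l z * norm x"
      by (metis dist_commute dist_norm norm_cauchy_schwarz)
    moreover have "(dist l z + d) * norm x \<le> e * norm x"
      using assms(3) by (rule mult_right_mono) simp
    ultimately show "norm (exp (z \<bullet> x + d * norm x)) \<le> norm (exp (l \<bullet> x + e * norm x))"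
      by (simp add: algebra_simps)
  qed
qed measurable

lemma integrable_exp_inner_growth:
  fixes M :: "'a::euclidean_space measure" and g :: "'a \<Rightarrow> 'b::{banach, second_countable_topology}"
  assumes [measurable_cong]: "sets M = sets borel" and [measurable]: "g \<in> borel_measurable borel"
    and "integrable M (\<lambda>x. exp (l \<bullet> x + e * norm x))" and "e > 0"
    and g: "\<And>x. norm (g x) \<le> (1 + norm x) ^ 3"
  shows "integrable M (\<lambda>x. exp (l \<bullet> x) *\<^sub>R g x)"
proof (rule Bochner_Integration.integrable_bound)
  show "integrable M (\<lambda>x. (1 + 3 / e) ^ 3 * exp (l \<bullet> x + e * norm x))"
    using assms by simp
  show "AE x in M. norm (exp (l \<bullet> x) *\<^sub>R g x) \<le> norm ((1 + 3 / e) ^ 3 * exp (l \<bullet> x + e * norm x))"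
  proof (rule AE_I2)
    fix x
    have "norm (g x) \<le> (1 + 3 / e) ^ 3 * exp (e * norm x)"
      using g[of x] cubic_le_exp[of "norm x" e] assms(4) by auto
    then have "exp (l \<bullet> x) * norm (g x) \<le> exp (l \<bullet> x) * ((1 + 3 / e) ^ 3 * exp (e * norm x))"
      by (intro mult_left_mono) auto
    then show "norm (exp (l \<bullet> x) *\<^sub>R g x) \<le> norm ((1 + 3 / e) ^ 3 * exp (l \<bullet> x + e * norm x))"
      using assms(4) by (simp add: exp_add ac_simps abs_mult)
  qed
qed measurable

lemma norm_power_le_cubic: "k \<le> 3 \<Longrightarrow> norm x ^ k \<le> (1 + norm x) ^ 3"
  by (rule order_trans[OF power_mono power_increasing]) auto

text \<open>These are the integrands of the unnormalised mean and of the second moment contracted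
  with \<open>h\<close>; their integrability lets inner products pass through the vector-valued
  integrals.\<close>

lemma
  fixes M :: "'a::euclidean_space measure"
  assumes sets: "sets M = sets borel"
    and int: "integrable M (\<lambda>x. exp (l \<bullet> x + e * norm x))" and e: "e > 0"
  shows integrable_exp_inner_scaleR_id: "integrable M (\<lambda>x. exp (l \<bullet> x) *\<^sub>R x)"
    and integrable_exp_inner_scaleR_inner_id: "integrable M (\<lambda>x. exp (l \<bullet> x) *\<^sub>R (h \<bullet> x) *\<^sub>R x)"
proof -
  show "integrable M (\<lambda>x. exp (l \<bullet> x) *\<^sub>R x)"
    using norm_power_le_cubic[of 1] by (intro integrable_exp_inner_growth[OF sets _ int e]) auto
  have "integrable M (\<lambda>x. exp (l \<bullet> x) *\<^sub>R (norm x)\<^sup>2)"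
    using norm_power_le_cubic[of 2] by (intro integrable_exp_inner_growth[OF sets _ int e]) auto
  then have "integrable M (\<lambda>x. norm h * (exp (l \<bullet> x) *\<^sub>R (norm x)\<^sup>2))"
    by simp
  then show "integrable M (\<lambda>x. exp (l \<bullet> x) *\<^sub>R (h \<bullet> x) *\<^sub>R x)"
  proof (rule Bochner_Integration.integrable_bound)
    show "(\<lambda>x. exp (l \<bullet> x) *\<^sub>R (h \<bullet> x) *\<^sub>R x) \<in> borel_measurable M"
      unfolding measurable_cong_sets[OF sets refl] by measurable
    show "AE x in M. norm (exp (l \<bullet> x) *\<^sub>R (h \<bullet> x) *\<^sub>R x) \<le>
        norm (norm h * (exp (l \<bullet> x) *\<^sub>R (norm x)\<^sup>2))"
    proof (rule AE_I2)
      fix x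
      have "exp (l \<bullet> x) * (\<bar>h \<bullet> x\<bar> * norm x) \<le> exp (l \<bullet> x) * (norm h * norm x * norm x)"
        by (intro mult_left_mono mult_right_mono Cauchy_Schwarz_ineq2) auto
      then show "norm (exp (l \<bullet> x) *\<^sub>R (h \<bullet> x) *\<^sub>R x) \<le>
          norm (norm h * (exp (l \<bullet> x) *\<^sub>R (norm x)\<^sup>2))"
        by (simp add: power2_eq_square abs_mult mult_ac)
    qed
  qed
qed

section \<open>Differentiation under the integral sign\<close>

text \<open>One statement serves both orders of differentiation: \<open>g = 1\<close> differentiates
  the Laplace transform, \<open>g x = x\<close> the vector integral in its gradient. The Taylor
  remainder is integrated directly and is of order \<open>(norm h)\<^sup>2\<close>.\<close>

lemma has_derivative_integral_exp_inner:
  fixes M :: "'a::euclidean_space measure" and g :: "'a \<Rightarrow> 'b::{banach, second_countable_topology}"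
  assumes sets[measurable_cong]: "sets M = sets borel" and g[measurable]: "g \<in> borel_measurable borel"
    and int: "integrable M (\<lambda>x. exp (l \<bullet> x + e * norm x))" and e: "e > 0"
    and g_le: "\<And>x. norm (g x) \<le> 1 + norm x"
  shows "((\<lambda>z. \<integral>x. exp (z \<bullet> x) *\<^sub>R g x \<partial>M) has_derivative
      (\<lambda>h. \<integral>x. exp (l \<bullet> x) *\<^sub>R (h \<bullet> x) *\<^sub>R g x \<partial>M)) (at l)"
    (is "(?F has_derivative ?D) _")
proof -
  \<comment> \<open>Dominating function of the remainder. Half of the rate \<open>e\<close> pays for
    \<open>exp \<bar>h \<bullet> x\<bar>\<close> when \<open>norm h \<le> e/2\<close>; the other
    half absorbs the cubic factor, two powers of which come from the Taylor remainder and one from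
    \<open>g\<close>.\<close>
  let ?W = "\<lambda>x. exp (l \<bullet> x + e/2 * norm x) * (1 + norm x) ^ 3"
  have poly: "1 + norm x \<le> (1 + norm x) ^ 3" "norm x * (1 + norm x) \<le> (1 + norm x) ^ 3"
    "(norm x)\<^sup>2 * (1 + norm x) \<le> (1 + norm x) ^ 3" for x :: 'a
  proof -
    have "norm x ^ k * (1 + norm x) \<le> (1 + norm x) ^ 3" if "k \<le> 2" for k
    proof -
      have "norm x ^ k \<le> (1 + norm x) ^ k" by (intro power_mono) auto
      also have "\<dots> \<le> (1 + norm x) ^ 2" using that by (intro power_increasing) auto
      finally have "norm x ^ k * (1 + norm x) \<le> (1 + norm x) ^ 2 * (1 + norm x)"
        by (intro mult_right_mono) auto
      then show ?thesis by (simp add: power2_eq_square power3_eq_cube)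
    qed
    from this[of 0] this[of 1] this[of 2] show "1 + norm x \<le> (1 + norm x) ^ 3"
      "norm x * (1 + norm x) \<le> (1 + norm x) ^ 3"
      "(norm x)\<^sup>2 * (1 + norm x) \<le> (1 + norm x) ^ 3" by auto
  qed
  have F_int: "integrable M (\<lambda>x. exp (z \<bullet> x) *\<^sub>R g x)" if "dist l z \<le> e/2" for z
  proof (rule integrable_exp_inner_growth[OF sets g])
    show "integrable M (\<lambda>x. exp (z \<bullet> x + e/2 * norm x))"
      using that by (intro integrable_exp_inner_norm_nearby[OF sets int]) auto
    show "norm (g x) \<le> (1 + norm x) ^ 3" for x
      using g_le[of x] poly(1)[of x] by linarith
  qed (use e in simp)
  have D_bound: "norm ((h \<bullet> x) *\<^sub>R g x) \<le> norm h * (norm x * (1 + norm x))" for h x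
    using mult_mono[OF Cauchy_Schwarz_ineq2[of h x] g_le[of x]] by (simp add: ac_simps)
  have D_int: "integrable M (\<lambda>x. exp (l \<bullet> x) *\<^sub>R (h \<bullet> x) *\<^sub>R g x)" for h
  proof -
    have "integrable M (\<lambda>x. exp (l \<bullet> x) *\<^sub>R norm x *\<^sub>R (1 + norm x))"
    proof (rule integrable_exp_inner_growth[OF sets _ int e])
      show "norm (norm x *\<^sub>R (1 + norm x)) \<le> (1 + norm x) ^ 3" for x :: 'a
        using poly(2)[of x] by (simp add: abs_mult)
    qed measurable
    then have "integrable M (\<lambda>x. norm h * (exp (l \<bullet> x) *\<^sub>R norm x *\<^sub>R (1 + norm x)))"
      by simp
    then show ?thesis
    proof (rule Bochner_Integration.integrable_bound)
      show "AE x in M. norm (exp (l \<bullet> x) *\<^sub>R (h \<bullet> x) *\<^sub>R g x) \<le>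
          norm (norm h * (exp (l \<bullet> x) *\<^sub>R norm x *\<^sub>R (1 + norm x)))"
      proof (rule AE_I2)
        fix x
        have "exp (l \<bullet> x) * norm ((h \<bullet> x) *\<^sub>R g x) \<le> exp (l \<bullet> x) * (norm h * (norm x * (1 + norm x)))"
          by (intro mult_left_mono D_bound) auto
        then show "norm (exp (l \<bullet> x) *\<^sub>R (h \<bullet> x) *\<^sub>R g x) \<le>
          norm (norm h * (exp (l \<bullet> x) *\<^sub>R norm x *\<^sub>R (1 + norm x)))"
          by (simp add: abs_mult ac_simps)
      qed
    qed measurable
  qed
  have W_int: "integrable M ?W"
  proof (rule Bochner_Integration.integrable_bound)
    show "integrable M (\<lambda>x. (1 + 3 / (e/2)) ^ 3 * exp (l \<bullet> x + e * norm x))"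
      using int by simp
    show "AE x in M. norm (?W x) \<le> norm ((1 + 3 / (e/2)) ^ 3 * exp (l \<bullet> x + e * norm x))"
    proof (rule AE_I2)
      fix x :: 'a
      have "?W x \<le> exp (l \<bullet> x + e/2 * norm x) * ((1 + 3 / (e/2)) ^ 3 * exp (e/2 * norm x))"
        using e by (intro mult_left_mono cubic_le_exp) auto
      also have "\<dots> = (1 + 3 / (e/2)) ^ 3 * exp (l \<bullet> x + e * norm x)"
        by (simp add: mult.left_commute mult.commute flip: exp_add)
      finally show "norm (?W x) \<le> norm ((1 + 3 / (e/2)) ^ 3 * exp (l \<bullet> x + e * norm x))"
        using e by (simp add: abs_mult)
    qed
  qed measurable
  define C where "C = (\<integral>x. ?W x \<partial>M)"
  have remainder: "norm (?F (l + h) - ?F l - ?D h) \<le> C * (norm h)\<^sup>2" if h: "norm h \<le> e/2" for h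
  proof -
    have "?F (l + h) - ?F l - ?D h =
        (\<integral>x. exp ((l + h) \<bullet> x) *\<^sub>R g x - exp (l \<bullet> x) *\<^sub>R g x - exp (l \<bullet> x) *\<^sub>R (h \<bullet> x) *\<^sub>R g x \<partial>M)"
      using h e F_int[of l] F_int[of "l + h"] D_int[of h]
      by (simp add: dist_norm del: scaleR_scaleR)
    also have "norm \<dots> \<le> (\<integral>x. (norm h)\<^sup>2 * ?W x \<partial>M)"
    proof (rule Bochner_Integration.integral_norm_bound_integral)
      show "integrable M (\<lambda>x. exp ((l + h) \<bullet> x) *\<^sub>R g x - exp (l \<bullet> x) *\<^sub>R g x
          - exp (l \<bullet> x) *\<^sub>R (h \<bullet> x) *\<^sub>R g x)"
        using h e by (intro Bochner_Integration.integrable_diff F_int D_int) (auto simp: dist_norm)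
      show "integrable M (\<lambda>x. (norm h)\<^sup>2 * ?W x)" using W_int by simp
      fix x
      let ?t = "h \<bullet> x"
      have t: "\<bar>?t\<bar> \<le> norm h * norm x" by (rule Cauchy_Schwarz_ineq2)
      have "\<bar>?t\<bar> \<le> e/2 * norm x"
        using t mult_right_mono[OF h, of "norm x"] by simp
      then have "?t\<^sup>2 * exp \<bar>?t\<bar> \<le> (norm h * norm x)\<^sup>2 * exp (e/2 * norm x)"
        using t by (intro mult_mono) (auto simp: abs_le_square_iff[symmetric])
      with exp_taylor2_bound[of ?t]
      have "\<bar>exp ?t - 1 - ?t\<bar> \<le> (norm h * norm x)\<^sup>2 * exp (e/2 * norm x)" by linarith
      then have "\<bar>exp ?t - 1 - ?t\<bar> * norm (g x)
          \<le> ((norm h * norm x)\<^sup>2 * exp (e/2 * norm x)) * (1 + norm x)"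
        using g_le by (intro mult_mono) auto
      also have "\<dots> = (norm h)\<^sup>2 * exp (e/2 * norm x) * ((norm x)\<^sup>2 * (1 + norm x))"
        by (simp add: power_mult_distrib)
      also have "\<dots> \<le> (norm h)\<^sup>2 * exp (e/2 * norm x) * (1 + norm x) ^ 3"
        by (intro mult_left_mono poly) auto
      finally have "exp (l \<bullet> x) * (\<bar>exp ?t - 1 - ?t\<bar> * norm (g x))
          \<le> exp (l \<bullet> x) * ((norm h)\<^sup>2 * exp (e/2 * norm x) * (1 + norm x) ^ 3)"
        by (intro mult_left_mono) auto
      moreover have "exp ((l + h) \<bullet> x) *\<^sub>R g x - exp (l \<bullet> x) *\<^sub>R g x - exp (l \<bullet> x) *\<^sub>R ?t *\<^sub>R g x
          = (exp (l \<bullet> x) * (exp ?t - 1 - ?t)) *\<^sub>R g x"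
        by (simp add: inner_add_left exp_add algebra_simps)
      ultimately show "norm (exp ((l + h) \<bullet> x) *\<^sub>R g x - exp (l \<bullet> x) *\<^sub>R g x
          - exp (l \<bullet> x) *\<^sub>R ?t *\<^sub>R g x) \<le> (norm h)\<^sup>2 * ?W x"
        by (simp add: abs_mult exp_add mult_ac)
    qed
    also have "\<dots> = C * (norm h)\<^sup>2"
      by (simp add: C_def)
    finally show ?thesis .
  qed
  have lin: "linear ?D"
  proof (rule linearI)
    show "?D (h + k) = ?D h + ?D k" for h k
      using Bochner_Integration.integral_add[OF D_int[of h] D_int[of k]]
      by (simp add: inner_add_left scaleR_add_left scaleR_add_right del: scaleR_scaleR)
    show "?D (c *\<^sub>R h) = c *\<^sub>R ?D h" for c h
    proof -
      have "?D (c *\<^sub>R h) = (\<integral>x. c *\<^sub>R exp (l \<bullet> x) *\<^sub>R (h \<bullet> x) *\<^sub>R g x \<partial>M)"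
        by (simp add: mult.left_commute)
      then show ?thesis by (simp only: integral_scaleR_right)
    qed
  qed
  show ?thesis
    unfolding has_derivative_at
  proof (intro conjI)
    \<comment> \<open>Linearity suffices because the domain is finite-dimensional.\<close>
    show "bounded_linear ?D" using lin by (rule linear_conv_bounded_linear[THEN iffD1])
    have "((\<lambda>h. C * norm h) \<longlongrightarrow> 0) (at 0)"
      by (auto intro!: tendsto_eq_intros)
    then show "((\<lambda>h. norm (?F (l + h) - ?F l - ?D h) / norm h) \<longlongrightarrow> 0) (at 0)"
    proof (rule Lim_null_comparison[rotated])
      have "\<forall>\<^sub>F h in at 0. dist h 0 < e/2 \<and> h \<noteq> (0::'a)"
        using e by (auto simp: eventually_at intro!: exI[of _ "e/2"])
      then show "\<forall>\<^sub>F h in at 0. norm (norm (?F (l + h) - ?F l - ?D h) / norm h) \<le> C * norm h"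
      proof eventually_elim
        case (elim h)
        then have "norm (?F (l + h) - ?F l - ?D h) \<le> C * (norm h)\<^sup>2" by (intro remainder) auto
        with elim show ?case by (simp add: field_simps power2_eq_square)
      qed
    qed
  qed
qed

section \<open>Lower bound for an exponential integral over a set\<close>

lemma (in prob_space) prob_mult_exp_le_integral:
  fixes f :: "'a \<Rightarrow> real"
  assumes V[measurable]: "V \<in> events" and f: "integrable M f" and f2: "integrable M (\<lambda>x. (f x)\<^sup>2)"
    and ef: "integrable M (\<lambda>x. exp (- f x))"
  shows "prob V * exp (- (1 / sqrt (prob V)) * sqrt (expectation (\<lambda>x. (f x)\<^sup>2)))
    \<le> (\<integral>x. indicator V x * exp (- f x) \<partial>M)"
proof (cases "prob V = 0")
  \<comment> \<open>The factor \<open>prob V\<close> makes the left-hand side zero, whatever value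
    the division by zero takes.\<close>
  case True
  then show ?thesis by (simp add: integral_nonneg_AE)
next
  case False
  define p where "p = prob V"
  define q where "q = (\<integral>x. indicator V x * f x \<partial>M)"
  let ?S = "expectation (\<lambda>x. (f x)\<^sup>2)"
  have p: "p > 0" using False by (simp add: p_def zero_less_measure_iff)
  have iV: "integrable M (\<lambda>x. indicator V x :: real)"
    using V by (simp add: emeasure_eq_measure)
  have ifV: "integrable M (\<lambda>x. indicator V x * f x)"
    using integrable_mult_indicator[OF V f] by simp
  have ieV: "integrable M (\<lambda>x. indicator V x * exp (- f x))"
    using integrable_mult_indicator[OF V ef] by simp
  \<comment> \<open>Cauchy-Schwarz for \<open>f\<close> and the indicator of \<open>V\<close>:
    \<open>q / p\<close> is the mean of \<open>f\<close> on \<open>V\<close>, so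
    \<open>q / p * indicator V x\<close> is the projection of \<open>f\<close> onto the
    indicator.\<close>
  have "0 \<le> (\<integral>x. (f x - q / p * indicator V x)\<^sup>2 \<partial>M)"
    by (intro integral_nonneg_AE) simp
  also have "\<dots> = (\<integral>x. (f x)\<^sup>2 - 2 * (q / p) * (indicator V x * f x) + (q / p)\<^sup>2 * indicator V x \<partial>M)"
    by (intro Bochner_Integration.integral_cong)
      (auto simp: power2_diff power_mult_distrib split: split_indicator)
  also have "\<dots> = ?S - 2 * (q / p) * q + (q / p)\<^sup>2 * p"
    using f2 iV ifV by (simp add: q_def p_def)
  also have "\<dots> = ?S - q\<^sup>2 / p"
    using p by (simp add: field_simps power2_eq_square)
  finally have "(q / p)\<^sup>2 \<le> ?S / p"
    using p by (simp add: field_simps power2_eq_square)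
  then have "q / p \<le> sqrt (?S / p)" by (rule real_le_rsqrt)
  then have c: "q / p \<le> 1 / sqrt p * sqrt ?S" by (simp add: real_sqrt_divide)
  \<comment> \<open>Jensen's inequality on \<open>V\<close>: integrate the tangent line of \<open>exp\<close> at \<open>- q / p\<close>.\<close>
  have tangent: "exp (- (q / p)) * (1 + q / p - t) \<le> exp (- t)" for t
  proof -
    have "1 + (q / p - t) \<le> exp (q / p - t)" by (rule exp_ge_add_one_self)
    then have "exp (- (q / p)) * (1 + (q / p - t)) \<le> exp (- (q / p)) * exp (q / p - t)"
      by (intro mult_left_mono) auto
    then show ?thesis by (simp add: algebra_simps flip: exp_add)
  qed
  have "p * exp (- (1 / sqrt p * sqrt ?S)) \<le> p * exp (- (q / p))"
    using p c by (intro mult_left_mono) auto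
  \<comment> \<open>The linear part of the tangent contributes nothing, since
    \<open>f - q / p\<close> has integral zero over \<open>V\<close>.\<close>
  also have "\<dots> = exp (- (q / p)) * ((1 + q / p) * p - q)"
    using p by (simp add: field_simps)
  also have "\<dots> = (\<integral>x. exp (- (q / p)) * ((1 + q / p) * indicator V x - indicator V x * f x) \<partial>M)"
    using iV ifV by (simp add: q_def p_def)
  also have "\<dots> \<le> (\<integral>x. indicator V x * exp (- f x) \<partial>M)"
    using iV ifV ieV tangent by (intro integral_mono) (auto split: split_indicator)
  finally show ?thesis by (simp add: p_def)
qed

section \<open>Gradient and Hessian of the logarithmic Laplace transform\<close>

lemma exp_ereal_mono: "s \<le> t \<Longrightarrow> exp_ereal s \<le> exp_ereal t"
  by (cases s; cases t) (auto simp: exp_ereal_def)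

text \<open>Passage from the extended-real definition to a real logarithm. The integral is positive
  because a vanishing one would force the everywhere positive integrand to be zero almost
  everywhere.\<close>

lemma log_laplace_eq_ln:
  fixes l :: "'a::euclidean_space"
  assumes "prob_space M" and int: "integrable M (\<lambda>x. exp (l \<bullet> x))"
  shows "(\<integral>x. exp (l \<bullet> x) \<partial>M) > 0" "log_laplace M l = ereal (ln (\<integral>x. exp (l \<bullet> x) \<partial>M))"
proof -
  interpret prob_space M by fact
  have "(\<integral>x. exp (l \<bullet> x) \<partial>M) \<noteq> 0"
    using integral_nonneg_eq_0_iff_AE[OF int] prob_space AE_False by auto
  then show pos: "(\<integral>x. exp (l \<bullet> x) \<partial>M) > 0"
    by (simp add: order_less_le integral_nonneg_AE)
  have "(\<integral>\<^sup>+x. ennreal (exp (l \<bullet> x)) \<partial>M) = ennreal (\<integral>x. exp (l \<bullet> x) \<partial>M)"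
    using int by (intro nn_integral_eq_integral) auto
  then show "log_laplace M l = ereal (ln (\<integral>x. exp (l \<bullet> x) \<partial>M))"
    using pos by (simp add: log_laplace_def log_ennreal_def)
qed

text \<open>Resolves the definite description in \<open>gradient\<close>: derivatives are unique,
  and a vector is determined by its inner products.\<close>

lemma gradient_eqI:
  assumes "GDERIV (\<lambda>z. real_of_ereal (f z)) x :> D"
  shows "gradient f x = D"
  unfolding gradient_def
proof (rule the_equality)
  fix E assume "GDERIV (\<lambda>z. real_of_ereal (f z)) x :> E"
  then have "(\<lambda>h. h \<bullet> E) = (\<lambda>h. h \<bullet> D)"
    using assms unfolding gderiv_def by (rule has_derivative_unique)
  then show "E = D" by (metis inner_commute vector_eq_rdot)
qed (fact assms)

text \<open>Chain rule for the logarithm of the Laplace integral; the right-hand side is the mean of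
  the tilted measure.\<close>

lemma gradient_log_laplace:
  fixes l :: "'a::euclidean_space"
  assumes M: "prob_space M" and sets: "sets M = sets borel"
    and int: "integrable M (\<lambda>x. exp (l \<bullet> x + e * norm x))" and e: "e > 0"
  shows "gradient (log_laplace M) l = (1 / (\<integral>x. exp (l \<bullet> x) \<partial>M)) *\<^sub>R (\<integral>x. exp (l \<bullet> x) *\<^sub>R x \<partial>M)"
proof (rule gradient_eqI)
  let ?Z = "\<lambda>z. \<integral>x. exp (z \<bullet> x) \<partial>M"
  let ?G = "\<integral>x. exp (l \<bullet> x) *\<^sub>R x \<partial>M"
  have near: "integrable M (\<lambda>x. exp (z \<bullet> x))" if "dist l z \<le> e" for z
    using integrable_exp_inner_norm_nearby[OF sets int, of z 0] that by simp
  have Z: "?Z l > 0" using near e by (intro log_laplace_eq_ln[OF M]) simp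
  note G_int = integrable_exp_inner_scaleR_id[OF sets int e]
  have "(?Z has_derivative (\<lambda>h. \<integral>x. exp (l \<bullet> x) * (h \<bullet> x) \<partial>M)) (at l)"
    using has_derivative_integral_exp_inner[OF sets _ int e, of "\<lambda>_. 1 :: real"] by simp
  also have "(\<lambda>h. \<integral>x. exp (l \<bullet> x) * (h \<bullet> x) \<partial>M) = (\<lambda>h. h \<bullet> ?G)"
  proof
    fix h
    show "(\<integral>x. exp (l \<bullet> x) * (h \<bullet> x) \<partial>M) = h \<bullet> ?G"
      using integral_inner_right[of h M "\<lambda>x. exp (l \<bullet> x) *\<^sub>R x"] G_int by simp
  qed
  finally have "((\<lambda>z. ln (?Z z)) has_derivative (\<lambda>h. h \<bullet> ((1 / ?Z l) *\<^sub>R ?G))) (at l)"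
    using Z by (auto intro!: derivative_eq_intros simp: field_simps)
  then show "GDERIV (\<lambda>z. real_of_ereal (log_laplace M z)) l :> (1 / ?Z l) *\<^sub>R ?G"
    unfolding gderiv_def
  proof (rule has_derivative_transform_within_open)
    show "open (ball l e)" "l \<in> ball l e" using e by auto
    show "ln (?Z z) = real_of_ereal (log_laplace M z)" if "z \<in> ball l e" for z
      using log_laplace_eq_ln(2)[OF M, of z] near[of z] that by simp
  qed
qed

lemma hessian_mult_vector:
  assumes "(gradient f has_derivative D) (at x)"
  shows "hessian f x *v h = D h"
proof -
  have "frechet_derivative (gradient f) (at x) = D"
    using assms by (rule frechet_derivative_at[symmetric])
  then show ?thesis
    using has_derivative_linear[OF assms] by (simp add: hessian_def jacobian_def matrix_works)
qed

text \<open>The quotient rule applied to the gradient formula; the right-hand side is the covariance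
  of \<open>h \<bullet> x\<close> and \<open>k \<bullet> x\<close> under the tilted measure.\<close>

lemma hessian_log_laplace:
  fixes l :: "real ^ 'n"
  assumes M: "prob_space M" and sets: "sets M = sets borel"
    and int: "integrable M (\<lambda>x. exp (l \<bullet> x + e * norm x))" and e: "e > 0"
  defines "Z \<equiv> \<integral>x. exp (l \<bullet> x) \<partial>M"
  shows "k \<bullet> (hessian (log_laplace M) l *v h) =
    (\<integral>x. exp (l \<bullet> x) * ((h \<bullet> x) * (k \<bullet> x)) \<partial>M) / Z -
    (\<integral>x. exp (l \<bullet> x) * (h \<bullet> x) \<partial>M) / Z * ((\<integral>x. exp (l \<bullet> x) * (k \<bullet> x) \<partial>M) / Z)"
proof -
  let ?Z = "\<lambda>z. \<integral>x. exp (z \<bullet> x) \<partial>M"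
  let ?G = "\<lambda>z. \<integral>x. exp (z \<bullet> x) *\<^sub>R x \<partial>M"
  let ?DG = "\<lambda>h. \<integral>x. exp (l \<bullet> x) *\<^sub>R (h \<bullet> x) *\<^sub>R x \<partial>M"
  let ?DZ = "\<lambda>h. \<integral>x. exp (l \<bullet> x) * (h \<bullet> x) \<partial>M"
  let ?D = "\<lambda>h. (1 / Z) *\<^sub>R ?DG h - (?DZ h / Z\<^sup>2) *\<^sub>R ?G l"
  have Z: "Z > 0" unfolding Z_def
    using integrable_exp_inner_norm_nearby[OF sets int, of l 0] e by (intro log_laplace_eq_ln[OF M]) simp
  have dZ: "(?Z has_derivative ?DZ) (at l)"
    using has_derivative_integral_exp_inner[OF sets _ int e, of "\<lambda>_. 1 :: real"] by simp
  have dG: "(?G has_derivative ?DG) (at l)"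
    using has_derivative_integral_exp_inner[OF sets _ int e, of "\<lambda>x. x"] by simp
  have "((\<lambda>z. (1 / ?Z z) *\<^sub>R ?G z) has_derivative ?D) (at l)"
    using Z by (auto intro!: derivative_eq_intros dZ dG simp: Z_def power2_eq_square field_simps)
  then have "(gradient (log_laplace M) has_derivative ?D) (at l)"
  proof (rule has_derivative_transform_within_open)
    \<comment> \<open>The gradient formula must hold on a whole neighbourhood. Radius
      \<open>e/2\<close> leaves every \<open>z\<close> in the ball a reserve of \<open>e/2\<close>,
      enough to apply \<open>gradient_log_laplace\<close> there.\<close>
    show "open (ball l (e/2))" "l \<in> ball l (e/2)" using e by auto
    show "(1 / ?Z z) *\<^sub>R ?G z = gradient (log_laplace M) z" if "z \<in> ball l (e/2)" for z
    proof -
      have "integrable M (\<lambda>x. exp (z \<bullet> x + e/2 * norm x))"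
        using that by (intro integrable_exp_inner_norm_nearby[OF sets int]) auto
      then have "gradient (log_laplace M) z = (1 / ?Z z) *\<^sub>R ?G z"
        using e by (intro gradient_log_laplace[OF M sets, of z "e/2"]) auto
      then show ?thesis by simp
    qed
  qed
  then have H: "hessian (log_laplace M) l *v h = ?D h" by (rule hessian_mult_vector)
  have "k \<bullet> ?G l = ?DZ k"
    using integral_inner_right[OF integrable_exp_inner_scaleR_id[OF sets int e], of k] by simp
  moreover have "k \<bullet> ?DG h = (\<integral>x. exp (l \<bullet> x) * ((h \<bullet> x) * (k \<bullet> x)) \<partial>M)"
    using integral_inner_right[OF integrable_exp_inner_scaleR_inner_id[OF sets int e], of k h]
    by (simp add: mult.assoc)
  ultimately show ?thesis
    unfolding H by (simp add: inner_diff_right power2_eq_square)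
qed

section \<open>The inequality via the tilted measure\<close>

theorem lemma1p9:
  fixes M :: "(real ^ 'n) measure" and V :: "(real ^ 'n) set" and l y :: "real ^ 'n"
    and M\<^sub>y :: "(real ^ 'n) measure"
  assumes "prob_space M"
    and "sets M = sets borel"
    and "\<not> (\<exists>H. hyperplane H \<and> measure_support M \<subseteq> H)"
    and "V \<in> sets borel"
    and "l \<in> interior (effective_domain (log_laplace M))"
    and "y = gradient (log_laplace M) l"
    and "M\<^sub>y = tilted_measure M l"
  shows "emeasure M V \<ge>
    exp_ereal (- legendre (log_laplace M) y) *
    ennreal (measure M\<^sub>y V *
      exp (- (1 / sqrt (measure M\<^sub>y V)) * sqrt (l \<bullet> (hessian (log_laplace M) l *v l))))"
proof -
  interpret prob_space M by fact
  note sets [measurable_cong] = \<open>sets M = sets borel\<close>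
  note V [measurable] = \<open>V \<in> sets borel\<close>
  obtain e where e: "e > 0" and int: "integrable M (\<lambda>x. exp (l \<bullet> x + e * norm x))"
    using integrable_exp_inner_norm[OF sets] assms(5) by blast
  define Z where "Z = (\<integral>x. exp (l \<bullet> x) \<partial>M)"
  \<comment> \<open>\<open>w\<close> is the real-valued density of the tilted measure,
    \<open>m\<close> turns out to be the tilted mean of \<open>l \<bullet> x\<close>, and
    \<open>f\<close> is that variable centred, namely \<open>l \<bullet> (x - y)\<close>.\<close>
  define w where "w x = exp (l \<bullet> x) / Z" for x
  define m where "m = l \<bullet> y"
  define f where "f x = l \<bullet> x - m" for x
  let ?N = "density M (\<lambda>x. ennreal (w x))"
  have int0: "integrable M (\<lambda>x. exp (l \<bullet> x))"
    using integrable_exp_inner_norm_nearby[OF sets int, of l 0] e by simp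
  have Z: "Z > 0" and L: "log_laplace M l = ereal (ln Z)"
    using log_laplace_eq_ln[OF prob_space_axioms int0] by (auto simp: Z_def)
  have int1: "integrable M (\<lambda>x. exp (l \<bullet> x) * (l \<bullet> x))"
    using integrable_inner_right[OF integrable_exp_inner_scaleR_id[OF sets int e], of l] by simp
  have int2: "integrable M (\<lambda>x. exp (l \<bullet> x) * (l \<bullet> x)\<^sup>2)"
    using integrable_inner_right[OF integrable_exp_inner_scaleR_inner_id[OF sets int e], of l l]
    by (simp add: power2_eq_square mult.assoc)
  have w [measurable]: "w \<in> borel_measurable borel" unfolding w_def by measurable
  have f [measurable]: "f \<in> borel_measurable borel" unfolding f_def by measurable
  have w0: "w x \<ge> 0" for x using Z by (simp add: w_def)
  have N: "M\<^sub>y = ?N"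
    using Z by (simp add: assms(7) tilted_measure_def L exp_ereal_def w_def exp_diff)
  have "integral\<^sup>L M w = 1"
    using Z by (simp add: w_def[abs_def] flip: Z_def)
  moreover have "integrable M w"
    unfolding w_def[abs_def] using int0 by simp
  ultimately have "(\<integral>\<^sup>+x. w x \<partial>M) = 1"
    using w0 by (simp add: nn_integral_eq_integral)
  then interpret N: prob_space ?N
    by (intro prob_spaceI) (simp add: emeasure_density cong: nn_integral_cong)
  have m: "m = (\<integral>x. exp (l \<bullet> x) * (l \<bullet> x) \<partial>M) / Z"
    using integral_inner_right[OF integrable_exp_inner_scaleR_id[OF sets int e], of l]
    by (simp add: m_def assms(6) gradient_log_laplace[OF prob_space_axioms sets int e] Z_def)
  have wf: "w x * f x = (exp (l \<bullet> x) * (l \<bullet> x) - m * exp (l \<bullet> x)) / Z" for x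
    using Z by (simp add: w_def f_def field_simps)
  have wf2: "w x * (f x)\<^sup>2 =
    (exp (l \<bullet> x) * (l \<bullet> x)\<^sup>2 - 2 * m * (exp (l \<bullet> x) * (l \<bullet> x)) + m\<^sup>2 * exp (l \<bullet> x)) / Z" for x
    using Z by (simp add: w_def f_def field_simps power2_eq_square)
  \<comment> \<open>The factor \<open>exp (- f x)\<close> undoes the tilt up to a constant, so its
    tilted integral over \<open>V\<close> is a multiple of \<open>measure M V\<close>.\<close>
  have we: "w x * exp (- f x) = exp m / Z" for x
    using Z by (simp add: w_def f_def exp_diff)
  have "integrable ?N f"
    using w0 int0 int1 by (subst integrable_real_density) (auto simp: wf)
  moreover have "integrable ?N (\<lambda>x. (f x)\<^sup>2)"
    using w0 int0 int1 int2 by (subst integrable_real_density) (auto simp: wf2)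
  moreover have "integrable ?N (\<lambda>x. exp (- f x))"
    using w0 by (subst integrable_real_density) (auto simp: we)
  moreover have "(\<integral>x. (f x)\<^sup>2 \<partial>?N) = l \<bullet> (hessian (log_laplace M) l *v l)"
  proof -
    have "(\<integral>x. (f x)\<^sup>2 \<partial>?N) = (\<integral>x. w x * (f x)\<^sup>2 \<partial>M)"
      using w0 by (subst integral_real_density) auto
    \<comment> \<open>The middle term uses that the integral of
      \<open>exp (l \<bullet> x) * (l \<bullet> x)\<close> equals \<open>m * Z\<close>.\<close>
    also have "\<dots> = ((\<integral>x. exp (l \<bullet> x) * (l \<bullet> x)\<^sup>2 \<partial>M) - 2 * m * (m * Z) + m\<^sup>2 * Z) / Z"
      using int0 int1 int2 Z by (simp add: wf2 m Z_def)
    also have "\<dots> = (\<integral>x. exp (l \<bullet> x) * (l \<bullet> x)\<^sup>2 \<partial>M) / Z - m * m"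
      using Z by (simp add: field_simps power2_eq_square)
    also have "\<dots> = l \<bullet> (hessian (log_laplace M) l *v l)"
      using hessian_log_laplace[OF prob_space_axioms sets int e, of l l]
      by (simp add: m Z_def power2_eq_square)
    finally show ?thesis .
  qed
  moreover have "(\<integral>x. indicator V x * exp (- f x) \<partial>?N) = exp m / Z * measure M V"
  proof -
    have "(\<integral>x. indicator V x * exp (- f x) \<partial>?N) = (\<integral>x. w x * (indicator V x * exp (- f x)) \<partial>M)"
      using w0 by (subst integral_real_density) auto
    also have "\<dots> = (\<integral>x. exp m / Z * indicator V x \<partial>M)"
      by (intro Bochner_Integration.integral_cong) (auto simp: we split: split_indicator)
    finally show ?thesis by (simp add: sets)
  qed
  ultimately have main: "measure M\<^sub>y V *
      exp (- (1 / sqrt (measure M\<^sub>y V)) * sqrt (l \<bullet> (hessian (log_laplace M) l *v l)))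
    \<le> exp m / Z * measure M V" (is "?R \<le> _")
    using N.prob_mult_exp_le_integral[of V f] by (simp add: N sets)
  \<comment> \<open>Evaluating the supremum at \<open>l\<close> bounds the prefactor by
    \<open>Z / exp m\<close>, the reciprocal of the constant in \<open>main\<close>, so the two
    cancel.\<close>
  have "ereal (l \<bullet> y) - log_laplace M l \<le> legendre (log_laplace M) y"
    unfolding legendre_def by (intro SUP_upper) simp
  then have "- legendre (log_laplace M) y \<le> ereal (ln Z - m)"
    unfolding L m_def by (cases "legendre (log_laplace M) y") auto
  then have "exp_ereal (- legendre (log_laplace M) y) \<le> ennreal (Z / exp m)"
    using exp_ereal_mono Z by (fastforce simp: exp_ereal_def exp_diff)
  then have "exp_ereal (- legendre (log_laplace M) y) * ennreal ?R
      \<le> ennreal (Z / exp m) * ennreal (exp m / Z * measure M V)"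
    by (intro mult_mono ennreal_leI main) auto
  also have "\<dots> = emeasure M V"
    using Z by (simp add: emeasure_eq_measure flip: ennreal_mult)
  finally show ?thesis .
qed

end
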